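(* Let $V$ be an inner product space over $\mathbb{R}$ or $\mathbb{C}$, let $n\ge 1$, and let $\mathbf{y}_1,\dots,\mathbf{y}_n\in V$ be linearly independent. Define vectors $\mathbf{c}_n,\mathbf{c}_{n-1},\dots,\mathbf{c}_1$ by descending recursion: $\mathbf{c}_n=\mathbf{y}_n$ and, for $k=n-1,\dots,2,1$, $$\alpha_k=\frac{\left\langle \mathbf{y}_k,\sum_{i=k+1}^{n}\mathbf{c}_i\right\rangle}{\left\langle \sum_{i=k+1}^{n}\mathbf{c}_i,\sum_{i=k+1}^{n}\mathbf{c}_i\right\rangle},\qquad \mathbf{c}_k=\mathbf{y}_k-\alpha_k\sum_{i=k+1}^{n}\mathbf{c}_i .$$ Then this recursion is well defined (all the denominators are nonzero), the vectors $\mathbf{c}_1,\dots,\mathbf{c}_n$ are linearly independent, they satisfy $$\left\langle \mathbf{c}_i,\sum_{j=i+1}^{n}\mathbf{c}_j\right\rangle=0\qquad\text{for } i=1,\dots,n-1,$$ and $$\left\lVert \sum_{i=1}^{n}\mathbf{c}_i\right\rVert^2=\sum_{i=1}^{n}\lVert \mathbf{c}_i\rVert^2 .$$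
   Context: The inner product $\langle\cdot,\cdot\rangle$ is linear in its first argument (and conjugate-linear in the second in the complex case), and $\lVert \mathbf{v}\rVert^2=\langle \mathbf{v},\mathbf{v}\rangle$. *)

theory Defs
  imports "HOL-Analysis.Inner_Product"
begin

text \<open>
  Real inner product spaces are the library class \<open>real_inner\<close>. The locale below is the
  complex counterpart, with a form linear in the first argument; \<open>vector_space\<close> supplies the
  vector space axioms. That \<open>ip x x\<close> is real follows from \<open>ip_cnj\<close>.
\<close>

locale complex_inner_product_space = vector_space scale
  for scale :: "complex \<Rightarrow> 'v::ab_group_add \<Rightarrow> 'v" +
  fixes ip :: "'v \<Rightarrow> 'v \<Rightarrow> complex"
  assumes ip_add_left: "ip (x + y) z = ip x z + ip y z"
    and ip_scale_left: "ip (scale a x) z = a * ip x z"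
    and ip_cnj: "ip y x = cnj (ip x y)"
    and ip_ge_zero: "0 \<le> Re (ip x x)"
    and ip_eq_zero_iff: "ip x x = 0 \<longleftrightarrow> x = 0"

definition ip_norm :: "('v \<Rightarrow> 'v \<Rightarrow> complex) \<Rightarrow> 'v \<Rightarrow> real" where
  "ip_norm ip v = sqrt (Re (ip v v))"

text \<open>
  The library's \<open>dependent\<close> is about sets, so injectivity is needed to express independence of
  a family (no repeated vectors).
\<close>

definition lin_indep_family ::
  "('k::field \<Rightarrow> 'v::ab_group_add \<Rightarrow> 'v) \<Rightarrow> (nat \<Rightarrow> 'v) \<Rightarrow> nat set \<Rightarrow> bool" where
  "lin_indep_family scale f I \<longleftrightarrow> inj_on f I \<and> \<not> module.dependent scale (f ` I)"

text \<open>
  The recursion is descending in \<open>k\<close>, from \<open>k = n\<close>; only the values at \<open>k = 1, \<dots>, n\<close>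
  matter. Division by zero yields zero here, so well-definedness of the recursion is the separate
  claim that every denominator \<open>ip s s\<close> is nonzero.
\<close>

function cvec ::
  "('k::field \<Rightarrow> 'v::ab_group_add \<Rightarrow> 'v) \<Rightarrow> ('v \<Rightarrow> 'v \<Rightarrow> 'k) \<Rightarrow> (nat \<Rightarrow> 'v) \<Rightarrow> nat \<Rightarrow> nat \<Rightarrow> 'v" where
  "cvec scale ip y n k =
     (if k < n then
        let s = (\<Sum>i=k+1..n. cvec scale ip y n i);
            \<alpha> = ip (y k) s / ip s s
        in y k - scale \<alpha> s
      else y k)"
  by auto
termination
  by (relation "measure (\<lambda>(scale, ip, y, n, k). n - k)") auto

declare cvec.simps [simp del]

end

theory Submission
  imports Defs
begin

text \<open>
  Write \<open>s\<^sub>k\<close> for the tail sum of the \<open>c\<^sub>i\<close> with \<open>i > k\<close>. The recursion subtracts from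
  \<open>y\<^sub>k\<close> its projection onto the single vector \<open>s\<^sub>k\<close>, so \<open>c\<^sub>k\<close> is orthogonal to \<open>s\<^sub>k\<close> as soon as
  \<open>s\<^sub>k\<close> is not isotropic. The subtracted vector lies in the span of the
  later \<open>c\<^sub>i\<close>, so passing from \<open>y\<close> to \<open>c\<close> is a unitriangular change of basis: it preserves
  independence and the span of every tail (\<open>cvec_tail\<close>). Hence \<open>s\<^sub>k\<close>, being a sum of a
  nonempty independent family, is nonzero and the denominators do not vanish. The norm identity is
  then Pythagoras for \<open>c\<^sub>k + s\<^sub>k\<close>, iterated from the last vector down to the first
  (\<open>ip_tail_sum\<close>).

  Symmetry or conjugate symmetry of the inner product enters only through additivity in the second argument and symmetry of
  orthogonality. The argument is therefore carried out once, for forms over an arbitrary field with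
  these properties, and specialised to the real and the complex case.
\<close>

locale anisotropic_form_space = vector_space scale
  for scale :: "'k::field \<Rightarrow> 'v::ab_group_add \<Rightarrow> 'v" +
  fixes ip :: "'v \<Rightarrow> 'v \<Rightarrow> 'k"
  assumes form_add_left: "ip (u + v) w = ip u w + ip v w"
    and form_add_right: "ip w (u + v) = ip w u + ip w v"
    and form_scale_left: "ip (scale a v) w = a * ip v w"
    and form_orth_sym: "ip v w = 0 \<Longrightarrow> ip w v = 0"
    and form_anisotropic: "ip v v = 0 \<Longrightarrow> v = 0"

context vector_space
begin

lemma lin_indep_family_insert:
  assumes "k \<notin> I"
  shows "lin_indep_family scale f (insert k I) \<longleftrightarrow>
    lin_indep_family scale f I \<and> f k \<notin> span (f ` I)"
  using assms span_base[of "f k" "f ` I"]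
  by (auto simp: lin_indep_family_def independent_insert)

lemma span_insert_cong:
  assumes "span S = span T"
  shows "span (insert x S) = span (insert x T)"
  using assms by (simp add: span_insert)

text \<open>The first summand is not in the span of the others, so it cannot cancel against them.\<close>

lemma lin_indep_family_tail_sum_nonzero:
  assumes "lin_indep_family scale f {k..n}" "k \<le> n"
  shows "(\<Sum>i=k..n. f i) \<noteq> 0"
proof
  assume zero: "(\<Sum>i=k..n. f i) = 0"
  let ?r = "\<Sum>i=Suc k..n. f i"
  have "f k + ?r = 0"
    using zero assms(2) by (simp add: sum.atLeast_Suc_atMost)
  then have "f k = - ?r"
    by (simp add: eq_neg_iff_add_eq_0)
  moreover have "- ?r \<in> span (f ` {Suc k..n})"
    by (intro span_neg span_sum span_base imageI)
  moreover have "f k \<notin> span (f ` {Suc k..n})"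
    using assms lin_indep_family_insert[of k "{Suc k..n}" f]
    by (simp add: atLeastAtMost_insertL)
  ultimately show False
    by simp
qed

text \<open>
  The recursion is unitriangular: \<open>c\<^sub>k\<close> differs from \<open>y\<^sub>k\<close> by an element of the span of the
  later \<open>c\<^sub>i\<close>, so adjoining either one to that span gives the same subspace, and \<open>c\<^sub>k\<close> stays
  outside the span because \<open>y\<^sub>k\<close> does. Independence and equality of spans have to be carried
  through the descending induction together, since the span equality is what transfers
  \<open>y\<^sub>k \<notin> span\<close> from the later \<open>y\<^sub>i\<close> to the later \<open>c\<^sub>i\<close>.
\<close>

lemma cvec_tail:
  assumes "lin_indep_family scale y {1..n}" "1 \<le> k" "k \<le> n"
  shows "lin_indep_family scale (cvec scale ip y n) {k..n} \<and>
    span (cvec scale ip y n ` {k..n}) = span (y ` {k..n})"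
  using \<open>k \<le> n\<close> \<open>1 \<le> k\<close>
proof (induction k rule: inc_induct)
  case base
  have "{1..n} = insert n {1..<n}"
    using base by auto
  then have "y n \<noteq> 0"
    using assms(1) lin_indep_family_insert[of n "{1..<n}" y] span_zero by auto
  moreover have "cvec scale ip y n n = y n"
    by (simp add: cvec.simps)
  ultimately show ?case
    by (simp add: lin_indep_family_def)
next
  case (step k)
  let ?c = "cvec scale ip y n"
  let ?C = "?c ` {Suc k..n}" and ?Y = "y ` {Suc k..n}"
  have IH: "lin_indep_family scale ?c {Suc k..n}" "span ?C = span ?Y"
    using step by auto
  have ins: "{k..n} = insert k {Suc k..n}"
    using step by auto
  define s where "s = (\<Sum>i=Suc k..n. ?c i)"
  define u where "u = scale (ip (y k) s / ip s s) s"
  have ck: "?c k = y k - u"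
    using step.hyps by (subst cvec.simps) (simp add: Let_def s_def u_def)
  have u: "u \<in> span ?C"
    unfolding u_def s_def by (intro span_scale span_sum span_base imageI)
  have "{k..n} \<subseteq> {1..n}"
    using step.prems by auto
  then have "inj_on y {k..n}" "independent (y ` {k..n})"
    using assms(1) independent_mono[OF _ image_mono]
    unfolding lin_indep_family_def by (metis inj_on_subset, metis)
  then have "lin_indep_family scale y {k..n}"
    by (simp add: lin_indep_family_def)
  then have yk: "y k \<notin> span ?C"
    using lin_indep_family_insert[of k "{Suc k..n}" y] IH(2) by (simp add: ins)
  have "?c k \<notin> span ?C"
  proof
    assume "?c k \<in> span ?C"
    then have "?c k + u \<in> span ?C"
      using u by (rule span_add)
    then show False
      using yk ck by simp
  qed
  then have "lin_indep_family scale ?c {k..n}"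
    using lin_indep_family_insert[of k "{Suc k..n}" ?c] IH(1) by (simp add: ins)
  moreover have "span (insert (?c k) ?C) = span (insert (y k) ?C)"
    by (rule eq_span_insert_eq) (simp add: ck u span_neg)
  moreover have "span (insert (y k) ?C) = span (insert (y k) ?Y)"
    using IH(2) by (rule span_insert_cong)
  ultimately show ?case
    by (simp add: ins)
qed

end

context anisotropic_form_space
begin

lemma form_diff_left: "ip (u - v) w = ip u w - ip v w"
  using form_add_left[of "u - v" v w] by simp

lemma orthogonal_projection:
  assumes "ip s s \<noteq> 0"
  shows "ip (v - scale (ip v s / ip s s) s) s = 0"
  using assms by (simp add: form_diff_left form_scale_left)

lemma pythagoras:
  assumes "ip u v = 0"
  shows "ip (u + v) (u + v) = ip u u + ip v v"
  using assms form_orth_sym[OF assms] by (simp add: form_add_left form_add_right)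

lemma ip_tail_sum:
  assumes "\<And>i. m \<le> i \<Longrightarrow> i < n \<Longrightarrow> ip (c i) (\<Sum>j=Suc i..n. c j) = 0" "m \<le> n"
  shows "ip (\<Sum>i=m..n. c i) (\<Sum>i=m..n. c i) = (\<Sum>i=m..n. ip (c i) (c i))"
  using \<open>m \<le> n\<close>
proof (induction m rule: inc_induct)
  case base
  show ?case by simp
next
  case (step k)
  then show ?case
    using pythagoras[OF assms(1)[of k]] by (simp add: sum.atLeast_Suc_atMost)
qed

lemma cvec_properties:
  assumes indep: "lin_indep_family scale y {1..n}" and "1 \<le> n"
  defines "c \<equiv> cvec scale ip y n"
  shows "\<forall>k\<in>{1..<n}. ip (\<Sum>i=k+1..n. c i) (\<Sum>i=k+1..n. c i) \<noteq> 0"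
    and "lin_indep_family scale c {1..n}"
    and "\<forall>i\<in>{1..<n}. ip (c i) (\<Sum>j=i+1..n. c j) = 0"
    and "ip (\<Sum>i=1..n. c i) (\<Sum>i=1..n. c i) = (\<Sum>i=1..n. ip (c i) (c i))"
proof -
  show denominators: "\<forall>k\<in>{1..<n}. ip (\<Sum>i=k+1..n. c i) (\<Sum>i=k+1..n. c i) \<noteq> 0"
  proof
    fix k assume "k \<in> {1..<n}"
    then have "lin_indep_family scale c {k+1..n}" "k + 1 \<le> n"
      using cvec_tail[OF indep, of "k+1" ip] by (auto simp: c_def)
    then show "ip (\<Sum>i=k+1..n. c i) (\<Sum>i=k+1..n. c i) \<noteq> 0"
      using lin_indep_family_tail_sum_nonzero form_anisotropic by blast
  qed
  show "lin_indep_family scale c {1..n}"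
    using cvec_tail[OF indep, of 1 ip] \<open>1 \<le> n\<close> by (simp add: c_def)
  show orth: "\<forall>i\<in>{1..<n}. ip (c i) (\<Sum>j=i+1..n. c j) = 0"
  proof
    fix k assume k: "k \<in> {1..<n}"
    define s where "s = (\<Sum>i=k+1..n. c i)"
    have "c k = y k - scale (ip (y k) s / ip s s) s"
      using k unfolding s_def c_def by (subst cvec.simps) (simp add: Let_def)
    moreover have "ip s s \<noteq> 0"
      using denominators k unfolding s_def by blast
    ultimately show "ip (c k) (\<Sum>j=k+1..n. c j) = 0"
      using orthogonal_projection by (simp add: s_def)
  qed
  show "ip (\<Sum>i=1..n. c i) (\<Sum>i=1..n. c i) = (\<Sum>i=1..n. ip (c i) (c i))"
    using orth \<open>1 \<le> n\<close> by (intro ip_tail_sum) auto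
qed

end

lemma real_inner_anisotropic_form_space:
  "anisotropic_form_space scaleR (inner :: 'a::real_inner \<Rightarrow> 'a \<Rightarrow> real)"
  by unfold_locales (auto simp: inner_add_left inner_add_right inner_commute
      scaleR_add_right scaleR_add_left)

context complex_inner_product_space
begin

lemma anisotropic_form_space: "anisotropic_form_space scale ip"
proof unfold_locales
  fix u v w a
  show "ip (u + v) w = ip u w + ip v w" "ip (scale a v) w = a * ip v w"
    by (rule ip_add_left ip_scale_left)+
  show "ip w (u + v) = ip w u + ip w v"
    using ip_cnj[of w "u + v"] ip_cnj[of w u] ip_cnj[of w v] by (simp add: ip_add_left)
  show "ip w v = 0" if "ip v w = 0"
    using that ip_cnj[of w v] by simp
  show "v = 0" if "ip v v = 0"
    using that ip_eq_zero_iff by blast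
qed

lemma ip_norm_square: "(ip_norm ip v)\<^sup>2 = Re (ip v v)"
  by (simp add: ip_norm_def ip_ge_zero)

end

theorem mainTheorem1:
  fixes n :: nat
    and y :: "nat \<Rightarrow> 'a::real_inner"
    and scale :: "complex \<Rightarrow> 'b::ab_group_add \<Rightarrow> 'b"
    and ip :: "'b \<Rightarrow> 'b \<Rightarrow> complex"
    and z :: "nat \<Rightarrow> 'b"
  assumes "n \<ge> 1"
  shows "(lin_indep_family scaleR y {1..n} \<longrightarrow>
      (let c = cvec scaleR inner y n in
        (\<forall>k\<in>{1..<n}. inner (\<Sum>i=k+1..n. c i) (\<Sum>i=k+1..n. c i) \<noteq> 0) \<and>
        lin_indep_family scaleR c {1..n} \<and>
        (\<forall>i\<in>{1..<n}. inner (c i) (\<Sum>j=i+1..n. c j) = 0) \<and>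
        (norm (\<Sum>i=1..n. c i))\<^sup>2 = (\<Sum>i=1..n. (norm (c i))\<^sup>2)))
    \<and>
    (complex_inner_product_space scale ip \<and> lin_indep_family scale z {1..n} \<longrightarrow>
      (let c = cvec scale ip z n in
        (\<forall>k\<in>{1..<n}. ip (\<Sum>i=k+1..n. c i) (\<Sum>i=k+1..n. c i) \<noteq> 0) \<and>
        lin_indep_family scale c {1..n} \<and>
        (\<forall>i\<in>{1..<n}. ip (c i) (\<Sum>j=i+1..n. c j) = 0) \<and>
        (ip_norm ip (\<Sum>i=1..n. c i))\<^sup>2 = (\<Sum>i=1..n. (ip_norm ip (c i))\<^sup>2)))"
proof (intro conjI impI)
  assume indep: "lin_indep_family scaleR y {1..n}"
  interpret R: anisotropic_form_space scaleR "inner :: 'a \<Rightarrow> 'a \<Rightarrow> real"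
    by (rule real_inner_anisotropic_form_space)
  note props = R.cvec_properties[OF indep assms]
  show "let c = cvec scaleR inner y n in
      (\<forall>k\<in>{1..<n}. inner (\<Sum>i=k+1..n. c i) (\<Sum>i=k+1..n. c i) \<noteq> 0) \<and>
      lin_indep_family scaleR c {1..n} \<and>
      (\<forall>i\<in>{1..<n}. inner (c i) (\<Sum>j=i+1..n. c j) = 0) \<and>
      (norm (\<Sum>i=1..n. c i))\<^sup>2 = (\<Sum>i=1..n. (norm (c i))\<^sup>2)"
    unfolding Let_def power2_norm_eq_inner using props by blast
next
  assume asm: "complex_inner_product_space scale ip \<and> lin_indep_family scale z {1..n}"
  interpret C: complex_inner_product_space scale ip
    using asm by blast
  interpret F: anisotropic_form_space scale ip
    by (rule C.anisotropic_form_space)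
  note props = F.cvec_properties[OF conjunct2[OF asm] assms]
  show "let c = cvec scale ip z n in
      (\<forall>k\<in>{1..<n}. ip (\<Sum>i=k+1..n. c i) (\<Sum>i=k+1..n. c i) \<noteq> 0) \<and>
      lin_indep_family scale c {1..n} \<and>
      (\<forall>i\<in>{1..<n}. ip (c i) (\<Sum>j=i+1..n. c j) = 0) \<and>
      (ip_norm ip (\<Sum>i=1..n. c i))\<^sup>2 = (\<Sum>i=1..n. (ip_norm ip (c i))\<^sup>2)"
    unfolding Let_def C.ip_norm_square Re_sum[symmetric]
    using props by (intro conjI arg_cong[where f = Re])
qed

end
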